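(* For each odd integer $p\ge 5$, there exists at least one sign-unbalanced nut graph $\Gamma=(G,\Sigma)$ whose underlying graph $G$ is the cocktail-party graph of order $2p$, $\mathrm{CP}(2p)\cong\overline{p\,K_2}$.
   Context: The cocktail-party graph $\mathrm{CP}(2p)$ is the complement of the disjoint union $pK_2$ of $p$ edges. A signed graph $\Gamma=(G,\Sigma)$ is a finite simple graph $G=(V,E)$ (the underlying graph) with a distinguished set $\Sigma\subseteq E$ of negative edges. Its adjacency matrix $A(\Gamma)$ is obtained from the $0$-$1$ adjacency matrix of $G$ by replacing $1$ by $-1$ at entries corresponding to negative edges. A vector indexed by $V$ is full if it has no zero entry. $\Gamma$ is a signed nut graph if $\dim\ker A(\Gamma)=1$ and $\ker A(\Gamma)$ contains a full vector. Switching $\Gamma$ at $U\subseteq V$ produces $\Gamma^U=(G,\Sigma\,\triangle\,\partial U)$, where $\triangle$ is symmetric difference and $\partial U=\{uv\in E: u\in U, v\notin U\}$; two signed graphs over the same $G$ are switching equivalent if one is obtained from the other by a switching. $\Gamma=(G,\Sigma)$ is sign-balanced if it is switching equivalent to $(G,\emptyset)$, and sign-unbalanced otherwise. A sign-unbalanced nut graph is a signed nut graph that is sign-unbalanced. *)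

theory Defs
  imports Complex_Main "HOL-Library.Function_Algebras"
begin

record 'v graph =
  verts :: "'v set"
  edges :: "'v set set"

definition simple_graph :: "'v graph \<Rightarrow> bool" where
  "simple_graph G \<longleftrightarrow> finite (verts G) \<and> (\<forall>e\<in>edges G. e \<subseteq> verts G \<and> card e = 2)"

definition graph_complement :: "'v graph \<Rightarrow> 'v graph" where
  "graph_complement G =
     \<lparr>verts = verts G, edges = {e. e \<subseteq> verts G \<and> card e = 2 \<and> e \<notin> edges G}\<rparr>"

text \<open>The graph \<open>p K\<^sub>2\<close>: the two ends of the \<open>i\<close>-th edge are \<open>(i, False)\<close> and \<open>(i, True)\<close>.\<close>

definition disjoint_edges :: "nat \<Rightarrow> (nat \<times> bool) graph" where
  "disjoint_edges p =
     \<lparr>verts = {..<p} \<times> UNIV, edges = {{(i, False), (i, True)} | i. i < p}\<rparr>"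

text \<open>The cocktail-party graph of order \<open>2 * p\<close>; the argument is \<open>p\<close>, not the order.\<close>

definition cocktail_party :: "nat \<Rightarrow> (nat \<times> bool) graph" where
  "cocktail_party p = graph_complement (disjoint_edges p)"

record 'v sgraph =
  underlying :: "'v graph"
  negs :: "'v set set"

definition signed_graph :: "'v sgraph \<Rightarrow> bool" where
  "signed_graph \<Gamma> \<longleftrightarrow> simple_graph (underlying \<Gamma>) \<and> negs \<Gamma> \<subseteq> edges (underlying \<Gamma>)"

definition adj_matrix :: "'v sgraph \<Rightarrow> 'v \<Rightarrow> 'v \<Rightarrow> real" where
  "adj_matrix \<Gamma> u v =
     (if {u, v} \<in> negs \<Gamma> then -1 else if {u, v} \<in> edges (underlying \<Gamma>) then 1 else 0)"

text \<open>A vector indexed by the vertex set is a function that vanishes off the vertex set.\<close>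

definition adj_kernel :: "'v sgraph \<Rightarrow> ('v \<Rightarrow> real) set" where
  "adj_kernel \<Gamma> =
     {x. (\<forall>v. v \<notin> verts (underlying \<Gamma>) \<longrightarrow> x v = 0) \<and>
         (\<forall>u\<in>verts (underlying \<Gamma>). (\<Sum>v\<in>verts (underlying \<Gamma>). adj_matrix \<Gamma> u v * x v) = 0)}"

definition full_on :: "'v set \<Rightarrow> ('v \<Rightarrow> real) \<Rightarrow> bool" where
  "full_on V x \<longleftrightarrow> (\<forall>v\<in>V. x v \<noteq> 0)"

definition fun_scale :: "real \<Rightarrow> ('v \<Rightarrow> real) \<Rightarrow> 'v \<Rightarrow> real" where
  "fun_scale c x = (\<lambda>v. c * x v)"

text \<open>The additive structure on functions is the pointwise one.\<close>

interpretation fun_vs: vector_space "fun_scale :: real \<Rightarrow> ('v \<Rightarrow> real) \<Rightarrow> 'v \<Rightarrow> real"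
  by unfold_locales (auto simp: fun_scale_def plus_fun_def algebra_simps)

definition signed_nut_graph :: "'v sgraph \<Rightarrow> bool" where
  "signed_nut_graph \<Gamma> \<longleftrightarrow> signed_graph \<Gamma> \<and> fun_vs.dim (adj_kernel \<Gamma>) = 1 \<and>
     (\<exists>x\<in>adj_kernel \<Gamma>. full_on (verts (underlying \<Gamma>)) x)"

definition edge_boundary :: "'v graph \<Rightarrow> 'v set \<Rightarrow> 'v set set" where
  "edge_boundary G U = {{u, v} | u v. {u, v} \<in> edges G \<and> u \<in> U \<and> v \<notin> U}"

definition switching :: "'v sgraph \<Rightarrow> 'v set \<Rightarrow> 'v sgraph" where
  "switching \<Gamma> U =
     (let B = edge_boundary (underlying \<Gamma>) U
      in \<lparr>underlying = underlying \<Gamma>, negs = (negs \<Gamma> - B) \<union> (B - negs \<Gamma>)\<rparr>)"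

definition switching_equivalent :: "'v sgraph \<Rightarrow> 'v sgraph \<Rightarrow> bool" where
  "switching_equivalent \<Gamma> \<Gamma>' \<longleftrightarrow> (\<exists>U \<subseteq> verts (underlying \<Gamma>). \<Gamma>' = switching \<Gamma> U)"

definition sign_balanced :: "'v sgraph \<Rightarrow> bool" where
  "sign_balanced \<Gamma> \<longleftrightarrow> switching_equivalent \<Gamma> \<lparr>underlying = underlying \<Gamma>, negs = {}\<rparr>"

definition sign_unbalanced_nut_graph :: "'v sgraph \<Rightarrow> bool" where
  "sign_unbalanced_nut_graph \<Gamma> \<longleftrightarrow> signed_nut_graph \<Gamma> \<and> \<not> sign_balanced \<Gamma>"

end

theory Submission
  imports Defs
begin

text \<open>
  Write \<open>p = 2 * n + 1\<close>. The non-adjacent pairs of the cocktail-party graph are split into a block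
  of \<open>n\<close> pairs \<open>A\<^sub>i\<close>, a block of \<open>n\<close> pairs \<open>B\<^sub>i\<close> and one further pair, the hub. A pair carries two
  coordinates of a vector \<open>x\<close>: the sum and the difference of its two entries. A \<open>2 \<times> 2\<close> block of
  four equal signs between two pairs couples only their sums, and the block
  \<open>(+, -; -, +)\<close> couples only their differences. In the signing used here every \<open>A\<^sub>i\<close> is joined to
  every other \<open>A\<^sub>j\<close> and to \<open>B\<^sub>i\<close> through sums, and every \<open>B\<^sub>i\<close> to every other \<open>B\<^sub>j\<close> through
  differences. The blocks from \<open>A\<^sub>i\<close> to \<open>B\<^sub>j\<close> with \<open>i \<noteq> j\<close> and those to the hub have a single negative
  entry: one of their rows reads the sum of the other pair and one reads its difference.

  The kernel equations then involve the index \<open>i\<close> only through the coordinates of \<open>A\<^sub>i\<close> and \<open>B\<^sub>i\<close>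
  themselves and through totals over the blocks. They force the coordinates to be the same for all
  \<open>i\<close>. All pair sums in the blocks equal the hub sum, and the first hub row makes their
  total \<open>0\<close>, so all pair sums vanish. The differences in both blocks have a common value \<open>2 * c\<close>, and
  one more equation determines the hub difference as \<open>2 * c * (1 - n)\<close>. Hence the kernel is the line
  through the vector with entries \<open>(1, -1)\<close> on every block pair and \<open>(1 - n, n - 1)\<close> on the hub,
  which is full because \<open>n \<ge> 2\<close>
  (\<open>null_vector_in_adj_kernel\<close>, \<open>adj_kernel_two_block_unique\<close>).

  Switching changes an even number of signs on any triangle, so a triangle with exactly one
  negative edge shows that the graph is unbalanced (\<open>sign_balanced_triangle\<close>).
\<close>

section \<open>Cocktail-party graphs, lines and triangles\<close>

lemma verts_cocktail_party: "verts (cocktail_party p) = {..<p} \<times> UNIV"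
  by (simp add: cocktail_party_def graph_complement_def disjoint_edges_def)

lemma edge_cocktail_party_iff:
  "{(i, a), (j, b)} \<in> edges (cocktail_party p) \<longleftrightarrow> i < p \<and> j < p \<and> i \<noteq> j"
proof (cases "(i, a) = (j, b)")
  case True
  then show ?thesis
    by (auto simp: cocktail_party_def graph_complement_def disjoint_edges_def)
next
  case False
  then show ?thesis
    by (cases a; cases b)
      (auto simp: cocktail_party_def graph_complement_def disjoint_edges_def doubleton_eq_iff)
qed

lemma simple_graph_cocktail_party: "simple_graph (cocktail_party p)"
  by (auto simp: simple_graph_def cocktail_party_def graph_complement_def disjoint_edges_def)

lemma sum_lessThan_double_Suc:
  fixes f :: "nat \<Rightarrow> real"
  shows "(\<Sum>j<2 * n + 1. f j) = (\<Sum>j<n. f j) + (\<Sum>j<n. f (n + j)) + f (2 * n)"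
proof -
  have "(\<Sum>j<n + m. f j) = (\<Sum>j<n. f j) + (\<Sum>j<m. f (n + j))" for m
    by (induction m) auto
  from this[of n] show ?thesis
    by (simp add: mult_2)
qed

lemma sum_if_neq:
  fixes f g :: "nat \<Rightarrow> real"
  assumes "i < n"
  shows "(\<Sum>j<n. if i \<noteq> j then f j else g j) = (\<Sum>j<n. f j) - f i + g i"
proof -
  have "(\<Sum>j\<in>{..<n} - {i}. if i \<noteq> j then f j else g j) = (\<Sum>j\<in>{..<n} - {i}. f j)"
    by (rule sum.cong) auto
  then show ?thesis
    using assms by (simp add: sum.remove[of "{..<n}" i])
qed

lemma dim_line_eq_1:
  fixes x :: "'v \<Rightarrow> real"
  assumes "x v \<noteq> 0" and "K = range (\<lambda>c. fun_scale c x)"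
  shows "fun_vs.dim K = 1"
proof -
  have "x \<noteq> 0"
    using assms(1) by auto
  moreover have "K = fun_vs.span {x}"
    by (simp add: assms(2) fun_vs.span_singleton)
  ultimately show ?thesis
    by (simp add: fun_vs.dim_eq_card_independent)
qed

text \<open>
  The negative edges of a balanced graph form a cut, and a cut contains an even number of the
  edges of a triangle.
\<close>

lemma sign_balanced_triangle:
  assumes "sign_balanced \<Gamma>"
    and "{u, v} \<in> negs \<Gamma>"
    and "{u, w} \<in> edges (underlying \<Gamma>)" and "{v, w} \<in> edges (underlying \<Gamma>)"
  shows "{u, w} \<in> negs \<Gamma> \<or> {v, w} \<in> negs \<Gamma>"
proof -
  obtain U where "negs \<Gamma> = edge_boundary (underlying \<Gamma>) U"
    using assms(1)
    by (auto simp: sign_balanced_def switching_equivalent_def switching_def Let_def)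
  then show ?thesis
    using assms(2-4) unfolding edge_boundary_def
    by (smt (verit, ccfv_SIG) doubleton_eq_iff insert_commute mem_Collect_eq)
qed

section \<open>A signing with two blocks and a hub\<close>

text \<open>
  For \<open>i < n\<close>, the pair \<open>A\<^sub>i\<close> has index \<open>i\<close> and \<open>B\<^sub>i\<close> has index \<open>n + i\<close>; the hub has index \<open>2 * n\<close>.
  Since the edges are unordered, the first family contains both off-diagonal entries of every
  block between distinct \<open>B\<close> pairs.
\<close>

definition two_block_negs :: "nat \<Rightarrow> (nat \<times> bool) set set" where
  "two_block_negs n =
     {{(n + i, False), (n + j, True)} | i j. i < n \<and> j < n \<and> i \<noteq> j} \<union>
     {{(i, True), (n + j, True)} | i j. i < n \<and> j < n \<and> i \<noteq> j} \<union>
     {{(2 * n, True), (i, True)} | i. i < n} \<union>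
     {{(2 * n, True), (n + i, False)} | i. i < n}"

definition two_block_graph :: "nat \<Rightarrow> (nat \<times> bool) sgraph" where
  "two_block_graph n =
     \<lparr>underlying = cocktail_party (2 * n + 1), negs = two_block_negs n\<rparr>"

lemma signed_graph_two_block: "signed_graph (two_block_graph n)"
  by (auto simp: signed_graph_def two_block_graph_def two_block_negs_def
      simple_graph_cocktail_party edge_cocktail_party_iff)

lemma adj_two_block:
  assumes "i < n" "j < n"
  shows
    "adj_matrix (two_block_graph n) (i, a) (j, b) = of_bool (i \<noteq> j)"
    "adj_matrix (two_block_graph n) (i, a) (n + j, b) = (if i \<noteq> j \<and> a \<and> b then -1 else 1)"
    "adj_matrix (two_block_graph n) (n + i, a) (j, b) = (if i \<noteq> j \<and> a \<and> b then -1 else 1)"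
    "adj_matrix (two_block_graph n) (n + i, a) (n + j, b) =
       of_bool (i \<noteq> j) * (if a = b then 1 else -1)"
  using assms
  by (auto simp: adj_matrix_def two_block_graph_def edge_cocktail_party_iff
      two_block_negs_def doubleton_eq_iff)

lemma adj_two_block_hub:
  assumes "i < n"
  shows
    "adj_matrix (two_block_graph n) (i, a) (2 * n, b) = (if a \<and> b then -1 else 1)"
    "adj_matrix (two_block_graph n) (n + i, a) (2 * n, b) = (if \<not> a \<and> b then -1 else 1)"
    "adj_matrix (two_block_graph n) (2 * n, b) (i, a) = (if a \<and> b then -1 else 1)"
    "adj_matrix (two_block_graph n) (2 * n, b) (n + i, a) = (if \<not> a \<and> b then -1 else 1)"
  using assms
  by (auto simp: adj_matrix_def two_block_graph_def edge_cocktail_party_iff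
      two_block_negs_def doubleton_eq_iff)

lemma adj_two_block_hub_hub: "adj_matrix (two_block_graph n) (2 * n, a) (2 * n, b) = 0"
  by (auto simp: adj_matrix_def two_block_graph_def edge_cocktail_party_iff
      two_block_negs_def doubleton_eq_iff)

section \<open>The rows of the adjacency matrix\<close>

definition neighbour_sum :: "'v sgraph \<Rightarrow> ('v \<Rightarrow> real) \<Rightarrow> 'v \<Rightarrow> real" where
  "neighbour_sum \<Gamma> x u = (\<Sum>v\<in>verts (underlying \<Gamma>). adj_matrix \<Gamma> u v * x v)"

definition pair_sum :: "(nat \<times> bool \<Rightarrow> real) \<Rightarrow> nat \<Rightarrow> real" where
  "pair_sum x i = x (i, False) + x (i, True)"

definition pair_diff :: "(nat \<times> bool \<Rightarrow> real) \<Rightarrow> nat \<Rightarrow> real" where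
  "pair_diff x i = x (i, False) - x (i, True)"

lemma neighbour_sum_two_block:
  fixes n :: nat
  defines "\<Gamma> \<equiv> two_block_graph n"
  defines "term \<equiv> \<lambda>x u j. adj_matrix \<Gamma> u (j, False) * x (j, False)
                       + adj_matrix \<Gamma> u (j, True) * x (j, True)"
  shows "neighbour_sum \<Gamma> x u =
    (\<Sum>j<n. term x u j) + (\<Sum>j<n. term x u (n + j)) + term x u (2 * n)"
proof -
  have "neighbour_sum \<Gamma> x u = (\<Sum>j<2 * n + 1. term x u j)"
    unfolding neighbour_sum_def \<Gamma>_def term_def two_block_graph_def sgraph.simps
      verts_cocktail_party
    by (simp add: sum.cartesian_product' UNIV_bool)
  then show ?thesis
    by (simp only: sum_lessThan_double_Suc)
qed

text \<open>
  Each row of the adjacency matrix depends only on the coordinates of the pairs \<open>A\<^sub>i\<close>, \<open>B\<^sub>i\<close> and of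
  the hub, and on the four totals of sums and differences over the two blocks. This collapses the
  system to one whose shape does not depend on \<open>n\<close>.
\<close>

lemma neighbour_sum_two_block_block:
  assumes "i < n"
  shows
    "neighbour_sum (two_block_graph n) x (i, False) =
       (\<Sum>j<n. pair_sum x j) - pair_sum x i
       + (\<Sum>j<n. pair_sum x (n + j)) + pair_sum x (2 * n)"
    "neighbour_sum (two_block_graph n) x (i, True) =
       (\<Sum>j<n. pair_sum x j) - pair_sum x i + (\<Sum>j<n. pair_diff x (n + j))
       - pair_diff x (n + i) + pair_sum x (n + i) + pair_diff x (2 * n)"
    "neighbour_sum (two_block_graph n) x (n + i, False) =
       (\<Sum>j<n. pair_sum x j) + (\<Sum>j<n. pair_diff x (n + j))
       - pair_diff x (n + i) + pair_diff x (2 * n)"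
    "neighbour_sum (two_block_graph n) x (n + i, True) =
       (\<Sum>j<n. pair_diff x j) - pair_diff x i + pair_sum x i
       - (\<Sum>j<n. pair_diff x (n + j)) + pair_diff x (n + i) + pair_sum x (2 * n)"
proof -
  note [simp] = pair_sum_def pair_diff_def adj_two_block adj_two_block_hub
  have "neighbour_sum (two_block_graph n) x (i, False) =
      (\<Sum>j<n. if i \<noteq> j then pair_sum x j else 0)
      + (\<Sum>j<n. pair_sum x (n + j)) + pair_sum x (2 * n)"
    unfolding neighbour_sum_two_block
    by (intro arg_cong2[of _ _ _ _ "(+)"] sum.cong) (use assms in auto)
  then show "neighbour_sum (two_block_graph n) x (i, False) =
      (\<Sum>j<n. pair_sum x j) - pair_sum x i
      + (\<Sum>j<n. pair_sum x (n + j)) + pair_sum x (2 * n)"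
    by (simp add: sum_if_neq[OF assms] sum_negf del: pair_sum_def pair_diff_def)
  have "neighbour_sum (two_block_graph n) x (i, True) =
      (\<Sum>j<n. if i \<noteq> j then pair_sum x j else 0)
      + (\<Sum>j<n. if i \<noteq> j then pair_diff x (n + j) else pair_sum x (n + j)) + pair_diff x (2 * n)"
    unfolding neighbour_sum_two_block
    by (intro arg_cong2[of _ _ _ _ "(+)"] sum.cong) (use assms in auto)
  then show "neighbour_sum (two_block_graph n) x (i, True) =
      (\<Sum>j<n. pair_sum x j) - pair_sum x i + (\<Sum>j<n. pair_diff x (n + j))
      - pair_diff x (n + i) + pair_sum x (n + i) + pair_diff x (2 * n)"
    by (simp add: sum_if_neq[OF assms] sum_negf del: pair_sum_def pair_diff_def)
  have "neighbour_sum (two_block_graph n) x (n + i, False) =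
      (\<Sum>j<n. pair_sum x j)
      + (\<Sum>j<n. if i \<noteq> j then pair_diff x (n + j) else 0) + pair_diff x (2 * n)"
    unfolding neighbour_sum_two_block
    by (intro arg_cong2[of _ _ _ _ "(+)"] sum.cong) (use assms in auto)
  then show "neighbour_sum (two_block_graph n) x (n + i, False) =
      (\<Sum>j<n. pair_sum x j) + (\<Sum>j<n. pair_diff x (n + j))
      - pair_diff x (n + i) + pair_diff x (2 * n)"
    by (simp add: sum_if_neq[OF assms] sum_negf del: pair_sum_def pair_diff_def)
  have "neighbour_sum (two_block_graph n) x (n + i, True) =
      (\<Sum>j<n. if i \<noteq> j then pair_diff x j else pair_sum x j)
      + (\<Sum>j<n. if i \<noteq> j then - pair_diff x (n + j) else 0) + pair_sum x (2 * n)"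
    unfolding neighbour_sum_two_block
    by (intro arg_cong2[of _ _ _ _ "(+)"] sum.cong) (use assms in auto)
  then show "neighbour_sum (two_block_graph n) x (n + i, True) =
      (\<Sum>j<n. pair_diff x j) - pair_diff x i + pair_sum x i
      - (\<Sum>j<n. pair_diff x (n + j)) + pair_diff x (n + i) + pair_sum x (2 * n)"
    by (simp add: sum_if_neq[OF assms] sum_negf del: pair_sum_def pair_diff_def)
qed

lemma neighbour_sum_two_block_hub:
  "neighbour_sum (two_block_graph n) x (2 * n, False) =
     (\<Sum>j<n. pair_sum x j) + (\<Sum>j<n. pair_sum x (n + j))"
  "neighbour_sum (two_block_graph n) x (2 * n, True) =
     (\<Sum>j<n. pair_diff x j) - (\<Sum>j<n. pair_diff x (n + j))"
  by (simp_all add: neighbour_sum_two_block adj_two_block_hub adj_two_block_hub_hub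
      pair_sum_def pair_diff_def sum_subtractf sum.distrib sum_negf)

section \<open>The kernel\<close>

definition null_vector :: "nat \<Rightarrow> nat \<times> bool \<Rightarrow> real" where
  "null_vector n = (\<lambda>(i, a).
     (if i < 2 * n then 1 else if i = 2 * n then 1 - real n else 0) * (if a then -1 else 1))"

lemma adj_kernel_two_block_iff:
  "x \<in> adj_kernel (two_block_graph n) \<longleftrightarrow>
    (\<forall>i a. i > 2 * n \<longrightarrow> x (i, a) = 0) \<and>
    (\<forall>i<n. \<forall>a. neighbour_sum (two_block_graph n) x (i, a) = 0) \<and>
    (\<forall>i<n. \<forall>a. neighbour_sum (two_block_graph n) x (n + i, a) = 0) \<and>
    (\<forall>a. neighbour_sum (two_block_graph n) x (2 * n, a) = 0)"
proof -
  have split: "(\<forall>k<2 * n + 1. P k) \<longleftrightarrow> (\<forall>i<n. P i) \<and> (\<forall>i<n. P (n + i)) \<and> P (2 * n)"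
    for P :: "nat \<Rightarrow> bool"
  proof (intro iffI allI impI; (elim conjE)?)
    fix k
    assume *: "\<forall>i<n. P i" "\<forall>i<n. P (n + i)" "P (2 * n)" and "k < 2 * n + 1"
    then consider "k < n" | "k = n + (k - n)" "k - n < n" | "k = 2 * n"
      by linarith
    then show "P k"
      using * by cases metis+
  qed auto
  have "x \<in> adj_kernel (two_block_graph n) \<longleftrightarrow>
      (\<forall>i a. i > 2 * n \<longrightarrow> x (i, a) = 0) \<and>
      (\<forall>k<2 * n + 1. \<forall>a. neighbour_sum (two_block_graph n) x (k, a) = 0)"
    unfolding adj_kernel_def neighbour_sum_def[symmetric]
    by (auto simp: two_block_graph_def verts_cocktail_party not_less less_Suc_eq_le)
  then show ?thesis
    by (simp only: split)
qed

lemma null_vector_in_adj_kernel: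
  "fun_scale c (null_vector n) \<in> adj_kernel (two_block_graph n)"
  unfolding adj_kernel_two_block_iff all_bool_eq
  by (simp add: neighbour_sum_two_block_block neighbour_sum_two_block_hub)
    (simp add: pair_sum_def pair_diff_def fun_scale_def null_vector_def algebra_simps)

text \<open>
  The pair sums all equal the hub sum \<open>h\<close>, so the first hub row says \<open>2 * n * h = 0\<close>; this is where
  \<open>n > 0\<close> is used. For \<open>n = 0\<close> the hub is all there is, and the kernel is a plane.
\<close>

lemma adj_kernel_two_block_unique:
  assumes "x \<in> adj_kernel (two_block_graph n)" and "n > 0"
  shows "\<exists>c. x = fun_scale c (null_vector n)"
proof -
  define S T D E where
    "S = (\<Sum>j<n. pair_sum x j)" and "T = (\<Sum>j<n. pair_sum x (n + j))" and
    "D = (\<Sum>j<n. pair_diff x j)" and "E = (\<Sum>j<n. pair_diff x (n + j))"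
  define h k where "h = pair_sum x (2 * n)" and "k = pair_diff x (2 * n)"
  note defs = S_def[symmetric] T_def[symmetric] D_def[symmetric] E_def[symmetric]
    h_def[symmetric] k_def[symmetric]
  note ker = assms(1)[unfolded adj_kernel_two_block_iff all_bool_eq neighbour_sum_two_block_hub
      defs]
  have hub: "S + T = 0" "D = E"
    using ker by auto
  have block:
    "S - pair_sum x i + T + h = 0"
    "S - pair_sum x i + E - pair_diff x (n + i) + pair_sum x (n + i) + k = 0"
    "S + E - pair_diff x (n + i) + k = 0"
    "D - pair_diff x i + pair_sum x i - E + pair_diff x (n + i) + h = 0"
    if "i < n" for i
    using ker that neighbour_sum_two_block_block[OF that, of x, unfolded defs] by auto
  have s: "pair_sum x i = h" "pair_sum x (n + i) = h" if "i < n" for i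
    using block[OF that] hub by linarith+
  have "S = real n * h" "T = real n * h"
    by (simp_all add: S_def T_def s)
  with hub(1) assms(2) have "h = 0" "S = 0"
    by auto
  \<comment> \<open>The common value of all differences in the blocks is \<open>E + k\<close>; the null vector has difference \<open>2\<close>
    there, hence the factor.\<close>
  define c where "c = (E + k) / 2"
  have e: "pair_diff x (n + i) = 2 * c" "pair_diff x i = 2 * c" if "i < n" for i
    using block[OF that] hub \<open>h = 0\<close> \<open>S = 0\<close> unfolding c_def s(1)[OF that] by auto
  have "E = real n * (2 * c)"
    by (simp add: E_def e)
  then have k: "k = 2 * (c * (1 - real n))"
    by (simp add: c_def field_simps)
  have "x (j, a) = fun_scale c (null_vector n) (j, a)" for j a
  proof -
    consider "j < n" | "j = n + (j - n)" "j - n < n" | "j = 2 * n" | "j > 2 * n"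
      by linarith
    then show ?thesis
    proof cases
      case 1
      then show ?thesis
        using s(1)[of j] e(2)[of j] \<open>h = 0\<close>
        by (cases a) (auto simp: pair_sum_def pair_diff_def fun_scale_def null_vector_def)
    next
      case 2
      then show ?thesis
        using s(2)[of "j - n"] e(1)[of "j - n"] \<open>h = 0\<close>
        by (cases a) (auto simp: pair_sum_def pair_diff_def fun_scale_def null_vector_def)
    next
      case 3
      then show ?thesis
        using k \<open>h = 0\<close> h_def k_def
        by (cases a)
          (auto simp: pair_sum_def pair_diff_def fun_scale_def null_vector_def algebra_simps)
    next
      case 4
      then show ?thesis
        using ker by (cases a) (auto simp: fun_scale_def null_vector_def)
    qed
  qed
  then show ?thesis
    by (intro exI[of _ c] ext) auto
qed

lemma signed_nut_graph_two_block:
  assumes "n \<ge> 2"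
  shows "signed_nut_graph (two_block_graph n)"
proof -
  have "adj_kernel (two_block_graph n) = range (\<lambda>c. fun_scale c (null_vector n))"
    using adj_kernel_two_block_unique[of _ n] null_vector_in_adj_kernel assms by fastforce
  moreover have "null_vector n (0, False) \<noteq> 0"
    using assms by (simp add: null_vector_def)
  ultimately have "fun_vs.dim (adj_kernel (two_block_graph n)) = 1"
    by (intro dim_line_eq_1)
  moreover have "null_vector n \<in> adj_kernel (two_block_graph n)"
    using null_vector_in_adj_kernel[of 1 n] by (simp add: fun_scale_def)
  moreover have "full_on (verts (underlying (two_block_graph n))) (null_vector n)"
    using assms
    by (auto simp: full_on_def two_block_graph_def verts_cocktail_party null_vector_def)
  ultimately show ?thesis
    unfolding signed_nut_graph_def using signed_graph_two_block by blast
qed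

text \<open>
  The triangle uses one vertex of \<open>A\<^sub>0\<close>, one of \<open>B\<^sub>1\<close> and one of the hub; only its edge between the
  blocks is negative.
\<close>

lemma not_sign_balanced_two_block:
  assumes "n \<ge> 2"
  shows "\<not> sign_balanced (two_block_graph n)"
proof
  let ?\<Gamma> = "two_block_graph n"
  have neg: "{u, v} \<in> negs ?\<Gamma> \<longleftrightarrow> adj_matrix ?\<Gamma> u v = -1" for u v
    by (simp add: adj_matrix_def)
  have "{(0, True), (n + 1, True)} \<in> negs ?\<Gamma>"
    unfolding neg using assms by (simp only: adj_two_block) simp
  moreover have "{(0, True), (2 * n, False)} \<in> edges (underlying ?\<Gamma>)"
    "{(n + 1, True), (2 * n, False)} \<in> edges (underlying ?\<Gamma>)"
    using assms by (simp_all add: two_block_graph_def edge_cocktail_party_iff)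
  moreover assume "sign_balanced ?\<Gamma>"
  ultimately have "{(0, True), (2 * n, False)} \<in> negs ?\<Gamma> \<or>
      {(n + 1, True), (2 * n, False)} \<in> negs ?\<Gamma>"
    by (intro sign_balanced_triangle)
  then show False
    unfolding neg using assms by (simp only: adj_two_block_hub) simp
qed

theorem theorem13:
  fixes p :: nat
  assumes "odd p" and "p \<ge> 5"
  shows "\<exists>\<Gamma> :: (nat \<times> bool) sgraph.
           sign_unbalanced_nut_graph \<Gamma> \<and> underlying \<Gamma> = cocktail_party p"
proof -
  obtain n where p: "p = 2 * n + 1"
    using assms(1) by (elim oddE)
  then have "n \<ge> 2"
    using assms(2) by simp
  then have "sign_unbalanced_nut_graph (two_block_graph n)"
    by (simp add: sign_unbalanced_nut_graph_def signed_nut_graph_two_block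
        not_sign_balanced_two_block)
  moreover have "underlying (two_block_graph n) = cocktail_party p"
    by (simp add: two_block_graph_def p)
  ultimately show ?thesis
    by blast
qed

end
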